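(* Let $1<p\le\infty$, $1\le q\le\infty$ and $\alpha\in\mathbb{R}$. Then $\|\cdot\|_{(p,q;\alpha)}\lesssim\|\cdot\|_{p,q;\alpha}$, i.e. there is a constant $C>0$ such that $\|a\|_{(p,q;\alpha)}\le C\|a\|_{p,q;\alpha}$ for every $a\in\mathcal{M}$.
   Context: $\mathcal{M}$ is the set of all sequences $a=\{a_n\}_{n=1}^\infty$ with values in $[-\infty,\infty]$; $m$ is the counting measure on $\mathbb{N}=\{1,2,\dots\}$. The non-increasing rearrangement of $a\in\mathcal{M}$ is $a_n^*=\inf\{\lambda\in[0,\infty): m(\{k:|a_k|>\lambda\})\le n-1\}$ ($\inf\emptyset=\infty$), and the maximal sequence is $a_n^{**}=\frac1n\sum_{k=1}^n a_k^*$, $n\in\mathbb{N}$. Convention $1/\infty=0$. $\|a\|_q=(\sum_n|a_n|^q)^{1/q}$ for $0<q<\infty$ and $\|a\|_\infty=\sup_n|a_n|$. The Lorentz--Zygmund functionals are $\|a\|_{p,q;\alpha}=\big\|\{a_n^*\,n^{\frac1p-\frac1q}(1+\log n)^\alpha\}_n\big\|_q$ and $\|a\|_{(p,q;\alpha)}=\big\|\{a_n^{**}\,n^{\frac1p-\frac1q}(1+\log n)^\alpha\}_n\big\|_q$. *)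

theory Defs
  imports "HOL-Analysis.Analysis"
begin

text \<open>
  An extended-real sequence \<open>(a\<^sub>n)\<close>, \<open>n = 1, 2, \<dots>\<close>, is a function on \<^typ>\<open>nat\<close>
  whose value at \<open>0\<close> is irrelevant: none of the notions below depends on it.
\<close>

text \<open>Only used for exponents \<open>r > 0\<close>, with \<open>\<infinity>\<^sup>r = \<infinity>\<close>.\<close>

definition ennreal_powr :: "ennreal \<Rightarrow> real \<Rightarrow> ennreal" where
  "ennreal_powr x r = (if x = \<infinity> then \<infinity> else ennreal (enn2real x powr r))"

text \<open>The functional \<open>\<parallel>\<cdot>\<parallel>\<^sub>q\<close>, \<open>0 < q \<le> \<infinity>\<close>. Its arguments below are non-negative
  sequences, so no absolute value is taken.\<close>

definition lq_norm :: "ennreal \<Rightarrow> (nat \<Rightarrow> ennreal) \<Rightarrow> ennreal" where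
  "lq_norm q x =
     (if q = \<infinity> then (SUP n\<in>{1..}. x n)
      else ennreal_powr (\<Sum>n. ennreal_powr (x (Suc n)) (enn2real q)) (1 / enn2real q))"

text \<open>In \<^typ>\<open>ennreal\<close> the infimum of the empty set is \<open>\<infinity>\<close>, as required.\<close>

definition rearrangement :: "(nat \<Rightarrow> ereal) \<Rightarrow> nat \<Rightarrow> ennreal" where
  "rearrangement a n =
     Inf {l :: ennreal. l < \<infinity> \<and>
       emeasure (count_space {1..}) {k\<in>{1..}. e2ennreal \<bar>a k\<bar> > l} \<le> of_nat (n - 1)}"

definition maximal_seq :: "(nat \<Rightarrow> ereal) \<Rightarrow> nat \<Rightarrow> ennreal" where
  "maximal_seq a n = (\<Sum>k=1..n. rearrangement a k) / of_nat n"

text \<open>The weight \<open>n\<^bsup>1/p - 1/q\<^esup> (1 + log n)\<^sup>\<alpha>\<close>. In \<^typ>\<open>ennreal\<close> we have \<open>1 / \<infinity> = 0\<close>.\<close>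

definition LZ_weight :: "ennreal \<Rightarrow> ennreal \<Rightarrow> real \<Rightarrow> nat \<Rightarrow> real" where
  "LZ_weight p q \<alpha> n =
     real n powr (enn2real (1 / p) - enn2real (1 / q)) * (1 + ln (real n)) powr \<alpha>"

text \<open>\<open>\<parallel>a\<parallel>\<^bsub>p,q;\<alpha>\<^esub>\<close>\<close>

definition LZ_norm :: "ennreal \<Rightarrow> ennreal \<Rightarrow> real \<Rightarrow> (nat \<Rightarrow> ereal) \<Rightarrow> ennreal" where
  "LZ_norm p q \<alpha> a = lq_norm q (\<lambda>n. rearrangement a n * ennreal (LZ_weight p q \<alpha> n))"

text \<open>\<open>\<parallel>a\<parallel>\<^bsub>(p,q;\<alpha>)\<^esub>\<close>\<close>

definition LZ_max_norm :: "ennreal \<Rightarrow> ennreal \<Rightarrow> real \<Rightarrow> (nat \<Rightarrow> ereal) \<Rightarrow> ennreal" where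
  "LZ_max_norm p q \<alpha> a = lq_norm q (\<lambda>n. maximal_seq a n * ennreal (LZ_weight p q \<alpha> n))"

end

theory Submission
  imports Defs
begin

text \<open>
  Monotonicity of the rearrangement plays no role: for every non-negative sequence \<open>f\<close> the
  averaging operator is bounded in the weighted norm. With \<open>v\<^sub>n = n\<^bsup>1/p\<^esup> (1 + log n)\<^sup>\<alpha>\<close> and
  \<open>d = (1 - 1/p) / 2 > 0\<close>, one has \<open>v\<^sub>n \<le> C (n/k)\<^bsup>1 - d\<^esup> v\<^sub>k\<close> for \<open>k \<le> n\<close>, because a power of the
  logarithm grows more slowly than \<open>n\<^sup>d\<close>. Hence \<open>v\<^sub>n\<close> times the \<open>n\<close>-th average of \<open>f\<close> is at most
  \<open>C \<Sum>\<^bsub>k \<le> n\<^esub> (k/n)\<^sup>d v\<^sub>k f\<^sub>k / k\<close>. For the measure \<open>1/k\<close> the kernel \<open>(k/n)\<^sup>d\<close> has bounded row and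
  column sums, so Jensen's inequality and an exchange of summation give the \<open>\<ell>\<^sup>q\<close> bound.
\<close>

section \<open>Elementary inequalities: Jensen, sums of powers, growth of logarithms\<close>

text \<open>Jensen for the convex function \<open>x powr q\<close> with the weights
  \<open>w i\<close> divided by their total W. Clearing denominators leaves the factor
  \<open>W powr (q - 1)\<close>, which is monotone in W because \<open>q \<ge> 1\<close>, so W may
  be replaced by M.\<close>

lemma weighted_sum_powr_le:
  fixes w x :: "'a \<Rightarrow> real"
  assumes "finite S" and w: "\<And>i. i \<in> S \<Longrightarrow> 0 < w i" and x: "\<And>i. i \<in> S \<Longrightarrow> 0 \<le> x i"
    and M: "sum w S \<le> M" and q: "1 \<le> q"
  shows "(\<Sum>i\<in>S. w i * x i) powr q \<le> M powr (q - 1) * (\<Sum>i\<in>S. w i * x i powr q)"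
proof -
  \<comment> \<open>Terms with \<open>x i = 0\<close> vanish on both sides; without them Jensen is
    applied at points of the open half-line only.\<close>
  define T where "T = {i\<in>S. 0 < x i}"
  have T: "finite T" "T \<subseteq> S" using \<open>finite S\<close> by (auto simp: T_def)
  have eq1: "(\<Sum>i\<in>S. w i * x i) = (\<Sum>i\<in>T. w i * x i)"
    using \<open>finite S\<close> x by (intro sum.mono_neutral_right) (force simp: T_def)+
  have eq2: "(\<Sum>i\<in>S. w i * x i powr q) = (\<Sum>i\<in>T. w i * x i powr q)"
    using \<open>finite S\<close> x by (intro sum.mono_neutral_right) (force simp: T_def)+
  show ?thesis
  proof (cases "T = {}")
    case True
    then show ?thesis unfolding eq1 eq2 by simp
  next
    case False
    define W where "W = sum w T"
    have W: "0 < W" unfolding W_def using T False w by (intro sum_pos) auto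
    have "W \<le> sum w S" unfolding W_def
      using T \<open>finite S\<close> w by (intro sum_mono2) (auto intro: less_imp_le)
    with M have WM: "W \<le> M" by simp
    have "(\<Sum>i\<in>T. (w i / W) *\<^sub>R x i) powr q \<le> (\<Sum>i\<in>T. (w i / W) * x i powr q)"
    proof (rule convex_on_sum[OF T(1) False powr_convex[OF q]])
      show "(\<Sum>i\<in>T. w i / W) = 1"
        using W by (simp add: W_def flip: sum_divide_distrib)
    qed (use T W w in \<open>auto simp: T_def intro!: divide_nonneg_pos intro: less_imp_le\<close>)
    also have "(\<Sum>i\<in>T. (w i / W) *\<^sub>R x i) = (\<Sum>i\<in>T. w i * x i) / W"
      by (simp add: sum_divide_distrib)
    also have "(\<Sum>i\<in>T. (w i / W) * x i powr q) = (\<Sum>i\<in>T. w i * x i powr q) / W"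
      by (simp add: sum_divide_distrib)
    finally have *: "((\<Sum>i\<in>T. w i * x i) / W) powr q \<le> (\<Sum>i\<in>T. w i * x i powr q) / W" .
    have nn: "0 \<le> (\<Sum>i\<in>T. w i * x i)" "0 \<le> (\<Sum>i\<in>T. w i * x i powr q)"
      using T w x by (auto intro!: sum_nonneg mult_nonneg_nonneg less_imp_le[OF w])
    have "(\<Sum>i\<in>T. w i * x i) powr q = W powr q * ((\<Sum>i\<in>T. w i * x i) / W) powr q"
      using W nn by (simp add: powr_divide)
    also have "\<dots> \<le> W powr q * ((\<Sum>i\<in>T. w i * x i powr q) / W)"
      using * by (intro mult_left_mono) auto
    also have "\<dots> = W powr (q - 1) * (\<Sum>i\<in>T. w i * x i powr q)"
      using W by (simp add: powr_diff)
    also have "\<dots> \<le> M powr (q - 1) * (\<Sum>i\<in>T. w i * x i powr q)"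
      using W WM q nn by (intro mult_right_mono powr_mono2) auto
    finally show ?thesis unfolding eq1 eq2 .
  qed
qed

text \<open>Comparison with the integral of \<open>t powr (d - 1)\<close>, which is non-increasing
  for \<open>d \<le> 1\<close>: by the mean value theorem each term is at most an increment of
  \<open>n powr d / d\<close>, and the increments telescope.\<close>

lemma sum_powr_minus_one_le:
  fixes d :: real
  assumes "0 < d" "d \<le> 1"
  shows "(\<Sum>k=1..n. real k powr (d - 1)) \<le> real n powr d / d"
proof (induction n)
  case (Suc n)
  have "real (Suc n) powr (d - 1) \<le> (real (Suc n) powr d - real n powr d) / d"
  \<comment> \<open>The interval from 0 to 1 touches the singularity of the derivative; there the
    claim is just \<open>1 \<le> 1 / d\<close>.\<close>
  proof (cases "n = 0")
    case True
    then show ?thesis using assms by (simp add: field_simps)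
  next
    case False
    have "\<exists>z. real n < z \<and> z < real (Suc n) \<and> real (Suc n) powr d - real n powr d =
        (real (Suc n) - real n) * (d * z powr (d - 1))"
      using False by (intro MVT2 has_real_derivative_powr) auto
    then obtain z where z: "real n < z" "z < real (Suc n)"
      and eq: "real (Suc n) powr d - real n powr d = d * z powr (d - 1)" by auto
    have "real (Suc n) powr (d - 1) \<le> z powr (d - 1)"
      using z assms by (intro powr_mono2') auto
    then show ?thesis unfolding eq using assms by simp
  qed
  with Suc show ?case by (simp add: diff_divide_distrib)
qed simp

text \<open>Again an integral comparison, now with \<open>t powr (- d - 1)\<close>. The first term
  is kept apart, since k - 1 may be 0, and is at most \<open>k powr (- d)\<close> as
  \<open>k \<ge> 1\<close>. The bound is uniform in N.\<close>

lemma sum_powr_tail_le: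
  fixes d :: real
  assumes "0 < d" "0 < k" "k \<le> N"
  shows "(\<Sum>n=k..N. real n powr (- d - 1)) \<le> (1 + 1 / d) * real k powr (- d)"
proof -
  \<comment> \<open>The negative term in N makes the bound telescope in the induction; it is
    discarded afterwards.\<close>
  have "(\<Sum>n=k..N. real n powr (- d - 1))
      \<le> real k powr (- d - 1) + (real k powr (- d) - real N powr (- d)) / d"
    using assms(3)
  proof (induction N rule: dec_induct)
    case (step n)
    have "\<exists>z. real n < z \<and> z < real (Suc n) \<and> real (Suc n) powr (- d) - real n powr (- d) =
        (real (Suc n) - real n) * (- d * z powr (- d - 1))"
      using step assms by (intro MVT2 has_real_derivative_powr) auto
    then obtain z where z: "real n < z" "z < real (Suc n)"
      and eq: "real (Suc n) powr (- d) - real n powr (- d) = - d * z powr (- d - 1)" by auto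
    have "real (Suc n) powr (- d - 1) \<le> z powr (- d - 1)"
      using z assms by (intro powr_mono2') auto
    also have "\<dots> = (real n powr (- d) - real (Suc n) powr (- d)) / d"
      using eq assms by (simp add: field_simps)
    finally show ?case using step by (simp add: diff_divide_distrib)
  qed simp
  also have "\<dots> \<le> real k powr (- d) + real k powr (- d) / d"
    using assms by (intro add_mono powr_mono divide_right_mono) auto
  finally show ?thesis by (simp add: algebra_simps)
qed

text \<open>For \<open>\<alpha> \<le> 0\<close> the logarithmic factor is non-increasing in n and C
  = 1 works. Otherwise put t = n/k: then 1 + ln n is at most (1 + ln t)(1 + ln k), and
  \<open>ln t \<le> t powr e / e\<close> together with \<open>1 \<le> t powr e\<close> bounds the
  first factor.\<close>

lemma log_weight_quotient_bounded:
  fixes d \<alpha> :: real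
  assumes "0 < d"
  shows "\<exists>C>0. \<forall>k n. 1 \<le> k \<longrightarrow> k \<le> n \<longrightarrow>
    (1 + ln (real n)) powr \<alpha> \<le> C * (real n / real k) powr d * (1 + ln (real k)) powr \<alpha>"
proof (cases "\<alpha> \<le> 0")
  case True
  show ?thesis
  proof (intro exI[of _ 1] conjI allI impI)
    fix k n :: nat assume "1 \<le> k" "k \<le> n"
    then have "(1 + ln (real n)) powr \<alpha> \<le> 1 * (1 + ln (real k)) powr \<alpha>"
      using True by (auto intro!: powr_mono2' add_pos_nonneg)
    also have "\<dots> \<le> (1 * (real n / real k) powr d) * (1 + ln (real k)) powr \<alpha>"
      using \<open>1 \<le> k\<close> \<open>k \<le> n\<close> assms by (intro mult_right_mono) (auto intro!: ge_one_powr_ge_zero)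
    finally show "(1 + ln (real n)) powr \<alpha>
        \<le> 1 * (real n / real k) powr d * (1 + ln (real k)) powr \<alpha>" .
  qed simp
next
  case False
  then have a: "0 < \<alpha>" by simp
  \<comment> \<open>Chosen so that raising \<open>t powr e\<close> to the power
    \<open>\<alpha>\<close> gives exactly \<open>t powr d\<close>.\<close>
  define e where "e = d / \<alpha>"
  have e: "0 < e" "e * \<alpha> = d" using a assms by (auto simp: e_def)
  show ?thesis
  proof (intro exI[of _ "(1 + 1 / e) powr \<alpha>"] conjI allI impI)
    fix k n :: nat assume kn: "1 \<le> k" "k \<le> n"
    define t where "t = real n / real k"
    have t: "1 \<le> t" using kn by (simp add: t_def)
    have lk: "0 \<le> ln (real k)" using kn by simp
    have "1 + ln (real n) = 1 + ln t + ln (real k)"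
      using kn by (simp add: t_def ln_div)
    also have "\<dots> \<le> (1 + ln t) * (1 + ln (real k))"
      using t lk by (simp add: algebra_simps)
    also have "\<dots> \<le> ((1 + 1 / e) * t powr e) * (1 + ln (real k))"
    proof (rule mult_right_mono)
      show "1 + ln t \<le> (1 + 1 / e) * t powr e"
        using ln_powr_bound[OF t e(1)] ge_one_powr_ge_zero[OF t, of e] e(1)
        by (simp add: algebra_simps)
    qed (use lk in simp)
    finally have "(1 + ln (real n)) powr \<alpha> \<le> ((1 + 1 / e) * t powr e * (1 + ln (real k))) powr \<alpha>"
      using kn a by (intro powr_mono2) auto
    also have "\<dots> = (1 + 1 / e) powr \<alpha> * t powr d * (1 + ln (real k)) powr \<alpha>"
      using e lk t by (simp add: powr_mult powr_powr)
    finally show "(1 + ln (real n)) powr \<alpha> \<le>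
      (1 + 1 / e) powr \<alpha> * (real n / real k) powr d * (1 + ln (real k)) powr \<alpha>"
      by (simp add: t_def)
  qed (use e(1) add_pos_pos[of 1 "1 / e"] in auto)
qed

section \<open>The weighted Hardy inequality for real sequences\<close>

text \<open>Moving \<open>v n\<close> inside the sum and trading it for \<open>v k\<close> costs
  \<open>(n/k) powr (1 - d)\<close>; divided by n this is the kernel \<open>(k/n) powr d\<close>
  times 1/k. The grouping into kernel times \<open>v k * f k\<close> is the form Jensen
  takes.\<close>

lemma Hardy_kernel_bound:
  fixes v f :: "nat \<Rightarrow> real"
  assumes C: "\<And>k n. 1 \<le> k \<Longrightarrow> k \<le> n \<Longrightarrow> v n \<le> C * (real n / real k) powr (1 - d) * v k"
    and f: "\<And>k. 0 \<le> f k" and n: "1 \<le> n"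
  shows "v n * ((\<Sum>k=1..n. f k) / real n)
    \<le> C * (\<Sum>k=1..n. (real n powr (- d) * real k powr (d - 1)) * (v k * f k))"
proof -
  have "v n * ((\<Sum>k=1..n. f k) / real n) = (\<Sum>k=1..n. v n * f k / real n)"
    by (simp add: sum_divide_distrib sum_distrib_left)
  also have "\<dots> \<le> (\<Sum>k=1..n. C * ((real n powr (- d) * real k powr (d - 1)) * (v k * f k)))"
  proof (rule sum_mono)
    fix k assume k: "k \<in> {1..n}"
    have "v n * f k / real n \<le> (C * (real n / real k) powr (1 - d) * v k) * f k / real n"
      using C[of k n] f[of k] k by (intro divide_right_mono mult_right_mono) auto
    also have "\<dots> = C * (((real n / real k) powr (1 - d) / real n) * (v k * f k))"
      by simp
    also have "(real n / real k) powr (1 - d) / real n = real n powr (- d) * real k powr (d - 1)"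
    proof -
      have "real n powr (1 - d) = real n powr (- d) * real n"
        using n powr_add[of "real n" "- d" 1] by simp
      moreover have "real k powr (d - 1) = 1 / real k powr (1 - d)"
        using powr_minus_divide[of "real k" "1 - d"] by simp
      ultimately show ?thesis using n by (simp add: powr_divide)
    qed
    finally show "v n * f k / real n
      \<le> C * ((real n powr (- d) * real k powr (d - 1)) * (v k * f k))" .
  qed
  finally show ?thesis by (simp add: sum_distrib_left)
qed

text \<open>This is the total mass M fed to the Jensen estimate; it does not depend on n.\<close>

lemma Hardy_kernel_row_sum:
  fixes d :: real
  assumes "0 < d" "d \<le> 1" "1 \<le> n"
  shows "(\<Sum>k=1..n. real n powr (- d) * real k powr (d - 1)) \<le> 1 / d"
proof -
  have "(\<Sum>k=1..n. real n powr (- d) * real k powr (d - 1))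
      \<le> real n powr (- d) * (real n powr d / d)"
    unfolding sum_distrib_left[symmetric]
    using sum_powr_minus_one_le[OF assms(1,2)] by (rule mult_left_mono) simp
  also have "\<dots> = 1 / d" using assms by (simp add: powr_minus)
  finally show ?thesis .
qed

lemma weighted_Hardy_sup:
  fixes v f :: "nat \<Rightarrow> real"
  assumes C: "\<And>k n. 1 \<le> k \<Longrightarrow> k \<le> n \<Longrightarrow> v n \<le> C * (real n / real k) powr (1 - d) * v k"
    and "0 < d" "d \<le> 1" "0 \<le> C"
    and f: "\<And>k. 0 \<le> f k" and n: "1 \<le> n" and B: "\<And>k. 1 \<le> k \<Longrightarrow> v k * f k \<le> B" "0 \<le> B"
  shows "v n * ((\<Sum>k=1..n. f k) / real n) \<le> C / d * B"
proof -
  have "v n * ((\<Sum>k=1..n. f k) / real n)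
      \<le> C * (\<Sum>k=1..n. (real n powr (- d) * real k powr (d - 1)) * (v k * f k))"
    using C f n by (rule Hardy_kernel_bound)
  also have "\<dots> \<le> C * (\<Sum>k=1..n. (real n powr (- d) * real k powr (d - 1)) * B)"
    using B \<open>0 \<le> C\<close> by (intro mult_left_mono sum_mono) auto
  also have "\<dots> = C * ((\<Sum>k=1..n. real n powr (- d) * real k powr (d - 1)) * B)"
    by (simp only: sum_distrib_right)
  also have "\<dots> \<le> C * (1 / d * B)"
    using assms Hardy_kernel_row_sum[of d n] by (intro mult_left_mono mult_right_mono) auto
  finally show ?thesis by simp
qed

text \<open>The constant has three sources: \<open>C powr q\<close> from the growth of v,
  \<open>(1 / d) powr (q - 1)\<close> from Jensen with the row sums, and \<open>1 + 1 / d\<close>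
  from the column sums. Truncating both sides at the same N keeps the exchange of summation
  finite.\<close>

lemma weighted_Hardy_sum:
  fixes v f :: "nat \<Rightarrow> real"
  assumes C: "\<And>k n. 1 \<le> k \<Longrightarrow> k \<le> n \<Longrightarrow> v n \<le> C * (real n / real k) powr (1 - d) * v k"
    and d: "0 < d" "d \<le> 1" and "0 \<le> C" and q: "1 \<le> q"
    and f: "\<And>k. 0 \<le> f k" and v: "\<And>k. 0 \<le> v k"
  shows "(\<Sum>n=1..N. (v n * ((\<Sum>k=1..n. f k) / real n)) powr q / real n)
    \<le> C powr q * (1 / d) powr (q - 1) * (1 + 1 / d) * (\<Sum>k=1..N. (v k * f k) powr q / real k)"
proof -
  define D where "D = C powr q * (1 / d) powr (q - 1)"
  define g where "g k = (v k * f k) powr q" for k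
  have g: "0 \<le> g k" for k by (simp add: g_def)
  have "(\<Sum>n=1..N. (v n * ((\<Sum>k=1..n. f k) / real n)) powr q / real n)
    \<le> (\<Sum>n=1..N. D * (\<Sum>k=1..n. real n powr (- d) * real k powr (d - 1) * g k) / real n)"
  proof (intro sum_mono divide_right_mono)
    fix n assume "n \<in> {1..N}"
    then have n: "1 \<le> n" by simp
    let ?S = "\<Sum>k=1..n. (real n powr (- d) * real k powr (d - 1)) * (v k * f k)"
    have "(v n * ((\<Sum>k=1..n. f k) / real n)) powr q \<le> (C * ?S) powr q"
      using q f v n C by (intro powr_mono2 Hardy_kernel_bound)
        (auto intro!: mult_nonneg_nonneg divide_nonneg_nonneg sum_nonneg)
    also have "\<dots> = C powr q * ?S powr q" by (rule powr_mult)
    also have "\<dots> \<le> C powr q * ((1 / d) powr (q - 1) *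
        (\<Sum>k=1..n. (real n powr (- d) * real k powr (d - 1)) * (v k * f k) powr q))"
      using n d q f v Hardy_kernel_row_sum[OF d n]
      by (intro mult_left_mono weighted_sum_powr_le) auto
    finally show "(v n * ((\<Sum>k=1..n. f k) / real n)) powr q
        \<le> D * (\<Sum>k=1..n. real n powr (- d) * real k powr (d - 1) * g k)"
      by (simp add: D_def g_def mult.assoc)
  qed simp
  \<comment> \<open>The outer 1/n joins \<open>n powr (- d)\<close>, giving the exponent needed for
    the column sum over \<open>n \<ge> k\<close>.\<close>
  also have "\<dots> = (\<Sum>n=1..N. \<Sum>k=1..n. D * (real n powr (- d - 1) * real k powr (d - 1) * g k))"
    by (intro sum.cong) (simp_all add: sum_distrib_left sum_divide_distrib powr_diff mult_ac)
  also have "\<dots> = (\<Sum>k=1..N. \<Sum>n=k..N. D * (real n powr (- d - 1) * real k powr (d - 1) * g k))"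
    unfolding sum.Sigma[OF finite_atLeastAtMost ballI[OF finite_atLeastAtMost]]
    by (rule sum.reindex_bij_witness[of _ prod.swap prod.swap]) auto
  also have "\<dots> = (\<Sum>k=1..N. D * ((\<Sum>n=k..N. real n powr (- d - 1)) * real k powr (d - 1) * g k))"
    by (simp only: sum_distrib_left sum_distrib_right)
  also have "\<dots> \<le> (\<Sum>k=1..N. D * (((1 + 1 / d) * real k powr (- d)) * real k powr (d - 1) * g k))"
    using d g by (intro sum_mono mult_left_mono mult_right_mono sum_powr_tail_le)
      (auto simp: D_def)
  \<comment> \<open>The powers of k from the column sum and from the kernel combine to 1/k, the
    measure on the right-hand side.\<close>
  also have "\<dots> = (\<Sum>k=1..N. D * (1 + 1 / d) * (g k / real k))"
  proof (rule sum.cong)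
    fix k assume "k \<in> {1..N}"
    then have "real k powr (- d) * real k powr (d - 1) = 1 / real k"
      using powr_add[of "real k" "- d" "d - 1"] powr_neg_one[of "real k"] by simp
    moreover have "D * (((1 + 1 / d) * real k powr (- d)) * real k powr (d - 1) * g k)
        = D * (1 + 1 / d) * ((real k powr (- d) * real k powr (d - 1)) * g k)"
      by (simp only: mult.assoc)
    ultimately show "D * (((1 + 1 / d) * real k powr (- d)) * real k powr (d - 1) * g k)
        = D * (1 + 1 / d) * (g k / real k)"
      by simp
  qed simp
  finally show ?thesis by (simp add: D_def g_def sum_distrib_left)
qed

section \<open>Powers and norms with values in the extended half-line\<close>

lemma ennreal_powr_ennreal: "0 \<le> c \<Longrightarrow> ennreal_powr (ennreal c) r = ennreal (c powr r)"
  by (simp add: ennreal_powr_def)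

lemma ennreal_powr_mono:
  assumes "x \<le> y" "0 \<le> r"
  shows "ennreal_powr x r \<le> ennreal_powr y r"
proof (cases "y = \<infinity>")
  case False
  then have "x \<noteq> \<infinity>" using assms by (auto simp: top_unique)
  moreover have "enn2real x \<le> enn2real y"
    using assms False by (intro enn2real_mono) (auto simp: less_top)
  ultimately show ?thesis
    using assms False by (auto simp: ennreal_powr_def intro!: ennreal_leI powr_mono2)
qed (simp add: ennreal_powr_def)

lemma ennreal_powr_mult:
  assumes "0 < c"
  shows "ennreal_powr (ennreal c * y) r = ennreal (c powr r) * ennreal_powr y r"
proof (cases y)
  case (real z)
  then show ?thesis using assms
    by (simp add: ennreal_powr_ennreal powr_mult flip: ennreal_mult)
next
  case top
  then show ?thesis using assms by (simp add: ennreal_powr_def ennreal_mult_top)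
qed

text \<open>Disposes of sequences whose rearrangement is somewhere infinite: the right-hand side of
  the theorem is then infinite.\<close>

lemma lq_norm_eq_top:
  assumes "x n = \<infinity>" "1 \<le> n"
  shows "lq_norm q x = \<infinity>"
proof (cases "q = \<infinity>")
  case True
  have "x n \<le> (SUP n\<in>{1..}. x n)" using assms by (intro SUP_upper) auto
  then show ?thesis using True assms by (simp add: lq_norm_def top_unique)
next
  case False
  obtain m where m: "n = Suc m" using assms by (cases n) auto
  have "(\<Sum>i\<in>{m}. ennreal_powr (x (Suc i)) (enn2real q))
      \<le> (\<Sum>i. ennreal_powr (x (Suc i)) (enn2real q))"
    by (intro sum_le_suminf) auto
  then have "(\<Sum>i. ennreal_powr (x (Suc i)) (enn2real q)) = \<infinity>"
    using assms m by (simp add: ennreal_powr_def top_unique)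
  then show ?thesis using False by (simp add: lq_norm_def ennreal_powr_def)
qed

text \<open>Strict positivity matters because infinity times 0 is 0 in \<open>ennreal\<close>: an
  infinite entry must survive multiplication by the weight.\<close>

lemma LZ_weight_pos: "1 \<le> n \<Longrightarrow> 0 < LZ_weight p q \<alpha> n"
  unfolding LZ_weight_def using ln_ge_zero[of "real n"] by (intro mult_pos_pos) (auto simp: add_nonneg_eq_0_iff)

section \<open>Averages of finite sequences in the Lorentz-Zygmund weight\<close>

lemma lq_norm_averages_le:
  fixes p q :: ennreal and \<alpha> :: real
  assumes p: "1 < p" and q: "1 \<le> q"
  shows "\<exists>C>0. \<forall>f. (\<forall>k. 0 \<le> f k) \<longrightarrow>
    lq_norm q (\<lambda>n. ennreal ((\<Sum>k=1..n. f k) / real n * LZ_weight p q \<alpha> n))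
      \<le> ennreal C * lq_norm q (\<lambda>n. ennreal (f n * LZ_weight p q \<alpha> n))"
proof -
  define s where "s = enn2real (1 / p)"
  have s: "0 \<le> s" "s < 1"
  proof -
    show "s < 1"
    proof (cases p)
      case (real r)
      then have "1 < r" using p by (simp flip: ennreal_1 add: ennreal_less_iff)
      then show ?thesis by (simp add: s_def real divide_ennreal flip: ennreal_1)
    qed (simp add: s_def)
  qed (simp add: s_def)
  \<comment> \<open>Half of the gap between s = 1/p and 1, so that 1 - d = s + d: the part s pays
    for \<open>n powr s\<close>, the part d for the logarithm.\<close>
  define d where "d = (1 - s) / 2"
  have d: "0 < d" "d \<le> 1" using s by (auto simp: d_def)
  have sd: "1 - d = s + d" by (simp add: d_def field_simps)
  define v where "v n = real n powr s * (1 + ln (real n)) powr \<alpha>" for n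
  have v: "0 \<le> v n" for n by (simp add: v_def)
  obtain C where C: "0 < C" and ln_le: "\<And>k n. 1 \<le> k \<Longrightarrow> k \<le> n \<Longrightarrow>
    (1 + ln (real n)) powr \<alpha> \<le> C * (real n / real k) powr d * (1 + ln (real k)) powr \<alpha>"
    using log_weight_quotient_bounded[OF d(1), of \<alpha>] by blast
  have v_le: "v n \<le> C * (real n / real k) powr (1 - d) * v k" if "1 \<le> k" "k \<le> n" for k n
  proof -
    have "v n \<le> real n powr s * (C * (real n / real k) powr d * (1 + ln (real k)) powr \<alpha>)"
      unfolding v_def using ln_le[OF that] by (intro mult_left_mono) auto
    also have "real n powr s = (real n / real k) powr s * real k powr s"
      using that by (simp add: powr_divide)
    finally show ?thesis
      by (simp add: v_def sd powr_add mult_ac)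
  qed
  show ?thesis
  proof (cases q)
    case top
    have W: "LZ_weight p q \<alpha> n = v n" for n by (simp add: LZ_weight_def v_def s_def top)
    show ?thesis unfolding W
    proof (intro exI[of _ "C / d"] conjI allI impI)
      fix f :: "nat \<Rightarrow> real" assume f: "\<forall>k. 0 \<le> f k"
      let ?B = "SUP n\<in>{1..}. ennreal (f n * v n)"
      have "ennreal ((\<Sum>k=1..n. f k) / real n * v n) \<le> ennreal (C / d) * ?B" if n: "1 \<le> n" for n
      proof (cases ?B)
        case (real B)
        have "f k * v k \<le> B" if "1 \<le> k" for k
        proof -
          have "ennreal (f k * v k) \<le> ?B" using that by (intro SUP_upper) auto
          then show ?thesis using real by simp
        qed
        then have "v n * ((\<Sum>k=1..n. f k) / real n) \<le> C / d * B"
          using f n d C real by (intro weighted_Hardy_sup v_le) (auto simp: mult.commute)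
        then have "(\<Sum>k=1..n. f k) / real n * v n \<le> C / d * B" by (simp only: mult.commute)
        then have "ennreal ((\<Sum>k=1..n. f k) / real n * v n) \<le> ennreal (C / d * B)"
          by (rule ennreal_leI)
        also have "\<dots> = ennreal (C / d) * ?B"
          unfolding real(2) using real(1) C d by (intro ennreal_mult) auto
        finally show ?thesis .
      next
        case top
        show ?thesis unfolding top using C d by (simp add: ennreal_mult_top)
      qed
      then show "lq_norm q (\<lambda>n. ennreal ((\<Sum>k=1..n. f k) / real n * v n))
          \<le> ennreal (C / d) * lq_norm q (\<lambda>n. ennreal (f n * v n))"
        using top by (auto simp: lq_norm_def intro!: SUP_least)
    qed (use C d in simp)
  next
    case (real Q)
    then have Q: "1 \<le> Q" using q by (simp flip: ennreal_1)
    \<comment> \<open>The factor split off from v becomes 1/n after taking the power Q, which is the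
      measure in \<open>weighted_Hardy_sum\<close>.\<close>
    have W: "LZ_weight p q \<alpha> n = v n * real n powr (- (1 / Q))" for n
      using real Q
      by (simp add: LZ_weight_def v_def s_def divide_ennreal powr_diff powr_minus_divide flip: ennreal_1)
    have W_powr: "(x * LZ_weight p q \<alpha> n) powr Q = (v n * x) powr Q / real n"
      if "0 \<le> x" "1 \<le> n" for x n
    proof -
      have "(x * LZ_weight p q \<alpha> n) powr Q = ((v n * x) * real n powr (- (1 / Q))) powr Q"
        by (simp add: W mult_ac)
      also have "\<dots> = (v n * x) powr Q * (real n powr (- (1 / Q))) powr Q" by (rule powr_mult)
      also have "(real n powr (- (1 / Q))) powr Q = 1 / real n"
        using Q that powr_neg_one[of "real n"] by (simp add: powr_powr)
      finally show ?thesis by simp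
    qed
    define D where "D = C powr Q * (1 / d) powr (Q - 1) * (1 + 1 / d)"
    have D: "0 < D" using C d by (auto simp: D_def intro!: mult_pos_pos add_pos_pos)
    have lq: "lq_norm q (\<lambda>n. ennreal (g n * LZ_weight p q \<alpha> n))
        = ennreal_powr (\<Sum>n. ennreal ((v (Suc n) * g (Suc n)) powr Q / real (Suc n))) (1 / Q)"
      if "\<And>n. 0 \<le> g n" for g
    proof -
      have "ennreal_powr (ennreal (g (Suc n) * LZ_weight p q \<alpha> (Suc n))) Q
          = ennreal ((v (Suc n) * g (Suc n)) powr Q / real (Suc n))" for n
        using that[of "Suc n"] LZ_weight_pos[of "Suc n" p q \<alpha>]
        by (subst ennreal_powr_ennreal) (auto simp: W_powr simp del: of_nat_Suc)
      moreover have "q \<noteq> \<infinity>" "enn2real q = Q" using real by auto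
      ultimately show ?thesis by (simp only: lq_norm_def if_False)
    qed
    show ?thesis
    proof (intro exI[of _ "D powr (1 / Q)"] conjI allI impI)
      fix f :: "nat \<Rightarrow> real" assume f: "\<forall>k. 0 \<le> f k"
      define m where "m n = (\<Sum>k=1..n. f k) / real n" for n
      have m: "0 \<le> m n" for n using f by (auto simp: m_def intro!: divide_nonneg_nonneg sum_nonneg)
      let ?M = "\<lambda>n. ennreal ((v (Suc n) * m (Suc n)) powr Q / real (Suc n))"
      let ?F = "\<lambda>n. ennreal ((v (Suc n) * f (Suc n)) powr Q / real (Suc n))"
      have "(\<Sum>n. ?M n) \<le> ennreal D * (\<Sum>n. ?F n)"
        \<comment> \<open>The left series is the supremum of its partial sums, so the finite
          inequality suffices even when the right series diverges.\<close>
        unfolding suminf_eq_SUP[of ?M]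
      proof (rule SUP_least)
        fix N
        have "(\<Sum>n=1..N. (v n * m n) powr Q / real n)
            \<le> D * (\<Sum>n=1..N. (v n * f n) powr Q / real n)"
          unfolding D_def m_def using v_le d C Q f v by (intro weighted_Hardy_sum) auto
        then have "(\<Sum>n<N. (v (Suc n) * m (Suc n)) powr Q / real (Suc n))
            \<le> D * (\<Sum>n<N. (v (Suc n) * f (Suc n)) powr Q / real (Suc n))"
          unfolding One_nat_def sum.atLeast1_atMost_eq .
        then have "ennreal (\<Sum>n<N. (v (Suc n) * m (Suc n)) powr Q / real (Suc n))
            \<le> ennreal D * ennreal (\<Sum>n<N. (v (Suc n) * f (Suc n)) powr Q / real (Suc n))"
          using D by (simp add: sum_nonneg ennreal_leI flip: ennreal_mult)
        then have "(\<Sum>n<N. ?M n) \<le> ennreal D * (\<Sum>n<N. ?F n)"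
          by (subst (1 2) sum_ennreal) auto
        also have "\<dots> \<le> ennreal D * (\<Sum>n. ?F n)"
          by (intro mult_left_mono sum_le_suminf) auto
        finally show "(\<Sum>n<N. ?M n) \<le> ennreal D * (\<Sum>n. ?F n)" .
      qed
      then have "ennreal_powr (\<Sum>n. ?M n) (1 / Q) \<le> ennreal_powr (ennreal D * (\<Sum>n. ?F n)) (1 / Q)"
        using Q by (intro ennreal_powr_mono) auto
      also have "\<dots> = ennreal (D powr (1 / Q)) * ennreal_powr (\<Sum>n. ?F n) (1 / Q)"
        by (rule ennreal_powr_mult[OF D])
      finally show "lq_norm q (\<lambda>n. ennreal ((\<Sum>k=1..n. f k) / real n * LZ_weight p q \<alpha> n))
          \<le> ennreal (D powr (1 / Q)) * lq_norm q (\<lambda>n. ennreal (f n * LZ_weight p q \<alpha> n))"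
        unfolding m_def[symmetric] lq[of m, OF m] lq[of f, OF f[rule_format]] .
    qed (use D in simp)
  qed
qed

section \<open>Passage to rearrangements\<close>

lemma lq_norm_cong: "(\<And>n. 1 \<le> n \<Longrightarrow> x n = y n) \<Longrightarrow> lq_norm q x = lq_norm q y"
  by (auto simp: lq_norm_def intro!: SUP_cong)

theorem proposition5p3:
  fixes p q :: ennreal and \<alpha> :: real
  assumes "1 < p" and "p \<le> \<infinity>" and "1 \<le> q" and "q \<le> \<infinity>"
  shows "\<exists>C::real. C > 0 \<and>
    (\<forall>a :: nat \<Rightarrow> ereal. LZ_max_norm p q \<alpha> a \<le> ennreal C * LZ_norm p q \<alpha> a)"
proof -
  obtain C where C: "0 < C" and le: "\<And>f. (\<And>k. 0 \<le> f k) \<Longrightarrow>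
    lq_norm q (\<lambda>n. ennreal ((\<Sum>k=1..n. f k) / real n * LZ_weight p q \<alpha> n))
      \<le> ennreal C * lq_norm q (\<lambda>n. ennreal (f n * LZ_weight p q \<alpha> n))"
    using lq_norm_averages_le[OF assms(1,3), of \<alpha>] by blast
  have "LZ_max_norm p q \<alpha> a \<le> ennreal C * LZ_norm p q \<alpha> a" for a :: "nat \<Rightarrow> ereal"
  proof (cases "\<exists>n\<ge>1. rearrangement a n = \<infinity>")
    case True
    then obtain n where n: "1 \<le> n" "rearrangement a n = \<infinity>" by blast
    then have "rearrangement a n * ennreal (LZ_weight p q \<alpha> n) = \<infinity>"
      using LZ_weight_pos[OF n(1), of p q \<alpha>] by (simp add: ennreal_top_mult)
    then have "LZ_norm p q \<alpha> a = \<infinity>"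
      unfolding LZ_norm_def using n(1) by (rule lq_norm_eq_top)
    then show ?thesis using C by (simp add: ennreal_mult_top)
  next
    case False
    \<comment> \<open>All entries from index 1 on are finite here, so \<open>enn2real\<close> loses
      nothing there, and it is non-negative at index 0 as well.\<close>
    define f where "f k = enn2real (rearrangement a k)" for k
    have f: "0 \<le> f k" for k by (simp add: f_def)
    have fin: "rearrangement a k = ennreal (f k)" if "1 \<le> k" for k
      using False that by (simp add: f_def less_top)
    have max: "maximal_seq a n = ennreal ((\<Sum>k=1..n. f k) / real n)" if "1 \<le> n" for n
    proof -
      have "(\<Sum>k=1..n. rearrangement a k) = ennreal (\<Sum>k=1..n. f k)"
        using fin f by (subst sum_ennreal[symmetric]) auto
      then show ?thesis
        using that f by (simp add: maximal_seq_def divide_ennreal sum_nonneg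
            ennreal_of_nat_eq_real_of_nat)
    qed
    have "LZ_max_norm p q \<alpha> a
        = lq_norm q (\<lambda>n. ennreal ((\<Sum>k=1..n. f k) / real n * LZ_weight p q \<alpha> n))"
      unfolding LZ_max_norm_def using f less_imp_le[OF LZ_weight_pos]
      by (intro lq_norm_cong) (simp add: max sum_nonneg ennreal_mult del: times_divide_eq_left)
    moreover have "LZ_norm p q \<alpha> a = lq_norm q (\<lambda>n. ennreal (f n * LZ_weight p q \<alpha> n))"
      unfolding LZ_norm_def using f less_imp_le[OF LZ_weight_pos]
      by (intro lq_norm_cong) (simp add: fin ennreal_mult)
    ultimately show ?thesis using le[of f] f by simp
  qed
  with C show ?thesis by blast
qed

end
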